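(* Let $k\ge 2$. The limit $\lim_{n\to\infty} s_k(n)/k^n$ exists and equals a constant $\alpha_k$ satisfying $\alpha_k > 1 - 1/(k-1)$.
   Context: $\Sigma_k=\{0,\ldots,k-1\}$. A square is a nonempty word of the form $xx$. $s_k(n)$ is the number of length-$n$ words over $\Sigma_k$ having no square prefix (no nonempty prefix, possibly the whole word, that is a square). *)

theory Defs
  imports Complex_Main "HOL-Library.Sublist"
begin

definition alphabet :: "nat \<Rightarrow> nat set" where
  "alphabet k = {0..<k}"

definition is_square :: "'a list \<Rightarrow> bool" where
  "is_square w \<longleftrightarrow> (\<exists>x. x \<noteq> [] \<and> w = x @ x)"

definition has_square_prefix :: "'a list \<Rightarrow> bool" where
  "has_square_prefix w \<longleftrightarrow> (\<exists>p. prefix p w \<and> is_square p)"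

definition num_no_square_prefix :: "nat \<Rightarrow> nat \<Rightarrow> nat" where
  "num_no_square_prefix k n =
     card {w. set w \<subseteq> alphabet k \<and> length w = n \<and> \<not> has_square_prefix w}"

end

theory Submission
  imports Defs
begin

text \<open>Every extension of a word with a square prefix has a square prefix, so the ratios decrease
and converge. A union bound over the half-length \<open>i\<close> of a square prefix \<open>xx\<close> bounds the proportion
of the other words by \<open>\<Sum>i\<ge>1. k powr -i = 1/(k-1)\<close>. The inequality is strict because the roots
\<open>x = aa\<close> can be omitted: \<open>aaaa\<close> already begins with \<open>aa\<close>. This saves \<open>k/k^4\<close>.\<close>

definition words :: "nat \<Rightarrow> nat \<Rightarrow> nat list set" where
  "words k n = {w. set w \<subseteq> alphabet k \<and> length w = n}"

lemma finite_words [simp]: "finite (words k n)"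
  by (simp add: words_def alphabet_def finite_lists_length_eq)

lemma card_words [simp]: "card (words k n) = k ^ n"
  by (simp add: words_def alphabet_def card_lists_length_eq)

lemma num_no_square_prefix_eq:
  "num_no_square_prefix k n = card {w \<in> words k n. \<not> has_square_prefix w}"
  by (simp add: num_no_square_prefix_def words_def conj_assoc)

lemma has_square_prefix_append: "has_square_prefix w \<Longrightarrow> has_square_prefix (w @ v)"
  unfolding has_square_prefix_def by (meson prefix_prefix)

text \<open>Deleting the last letter creates no square prefix, so every word counted on the left
  arises from a counted word of length \<open>n\<close> by appending one of \<open>k\<close>
  letters. This makes the ratios monotone.\<close>

lemma num_no_square_prefix_Suc_le:
  "num_no_square_prefix k (Suc n) \<le> k * num_no_square_prefix k n"
proof -
  let ?S = "\<lambda>n. {w \<in> words k n. \<not> has_square_prefix w}"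
  have "?S (Suc n) \<subseteq> (\<lambda>(w, a). w @ [a]) ` (?S n \<times> alphabet k)"
  proof
    fix w assume w: "w \<in> ?S (Suc n)"
    then obtain v a where "w = v @ [a]"
      by (cases w rule: rev_cases) (auto simp: words_def)
    then show "w \<in> (\<lambda>(w, a). w @ [a]) ` (?S n \<times> alphabet k)"
      using w has_square_prefix_append[of v "[a]"]
      by (intro image_eqI[where x = "(v, a)"]) (auto simp: words_def)
  qed
  then have "card (?S (Suc n)) \<le> card (?S n \<times> alphabet k)"
    by (rule surj_card_le[rotated]) (simp add: alphabet_def)
  then show ?thesis
    by (simp add: num_no_square_prefix_eq card_cartesian_product alphabet_def mult.commute)
qed

text \<open>The exclusion only affects length 2; at every other length these are all the
  words.\<close>

definition square_roots :: "nat \<Rightarrow> nat \<Rightarrow> nat list set" where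
  "square_roots k i = {x \<in> words k i. \<forall>a. x \<noteq> [a, a]}"

lemma card_square_roots_le:
  "real (card (square_roots k i)) \<le> real k ^ i - (if i = 2 then real k else 0)"
proof (cases "i = 2")
  case True
  let ?D = "(\<lambda>a. [a, a]) ` alphabet k"
  have D: "?D \<subseteq> words k 2" "card ?D = k"
    by (auto simp: words_def card_image inj_on_def alphabet_def)
  have "square_roots k 2 = words k 2 - ?D"
    by (auto simp: square_roots_def words_def)
  then have "card (square_roots k 2) = k ^ 2 - k"
    using D by (simp add: card_Diff_subset finite_subset)
  then show ?thesis
    using True by (simp add: of_nat_diff power2_eq_square)
next
  case False
  have "card (square_roots k i) \<le> card (words k i)"
    by (rule card_mono) (auto simp: square_roots_def)
  then have "real (card (square_roots k i)) \<le> real (k ^ i)"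
    by (simp only: card_words of_nat_le_iff)
  then show ?thesis
    using False by simp
qed

text \<open>A word with a square prefix is determined by an admissible root \<open>x\<close> and the
  rest \<open>y\<close> after \<open>x @ x\<close>. The union need not be disjoint, since only an
  upper bound on the count is wanted.\<close>

lemma square_prefix_words_subset:
  "{w \<in> words k n. has_square_prefix w} \<subseteq>
     (\<Union>i\<in>{1..n div 2}. (\<lambda>(x, y). x @ x @ y) ` (square_roots k i \<times> words k (n - 2 * i)))"
proof
  fix w assume "w \<in> {w \<in> words k n. has_square_prefix w}"
  then obtain x y where w: "w \<in> words k n" "w = x @ x @ y" "x \<noteq> []"
    by (auto simp: has_square_prefix_def is_square_def prefix_def)
  have "\<exists>x y. w = x @ x @ y \<and> x \<noteq> [] \<and> (\<forall>a. x \<noteq> [a, a])"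
  proof (cases "\<exists>a. x = [a, a]")
    case True
    then obtain a where "x = [a, a]" ..
    \<comment> \<open>A forbidden root is traded for the root \<open>[a]\<close>: the second pair of
      letters \<open>a\<close> moves into the remainder.\<close>
    with w have "w = [a] @ [a] @ ([a, a] @ y) \<and> [a] \<noteq> [] \<and> (\<forall>b. [a] \<noteq> [b, b])"
      by simp
    then show ?thesis by blast
  qed (use w in blast)
  then obtain x y where xy: "w = x @ x @ y" "x \<noteq> []" "\<forall>a. x \<noteq> [a, a]" by blast
  have "x \<in> square_roots k (length x)" "y \<in> words k (n - 2 * length x)"
    using w(1) xy by (auto simp: square_roots_def words_def)
  moreover have "length x \<in> {1..n div 2}"
    using w(1) xy by (cases x) (auto simp: words_def)
  ultimately show "w \<in> (\<Union>i\<in>{1..n div 2}.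
      (\<lambda>(x, y). x @ x @ y) ` (square_roots k i \<times> words k (n - 2 * i)))"
    using xy(1) by (intro UN_I[of "length x"] image_eqI[of _ _ "(x, y)"]) auto
qed

text \<open>Multiplying by \<open>q - 1\<close> makes the sum telescope to
  \<open>1 - 1 / q ^ m\<close>, so the bound is uniform in \<open>m\<close>.\<close>

lemma sum_inverse_powers_le:
  fixes q :: real
  assumes "q > 1"
  shows "(\<Sum>i=1..m. 1 / q ^ i) \<le> 1 / (q - 1)"
proof -
  have "(q - 1) * (\<Sum>i=1..m. 1 / q ^ i) = 1 - 1 / q ^ m"
    using assms by (induction m) (simp_all add: distrib_left diff_divide_distrib left_diff_distrib)
  also have "\<dots> \<le> 1" using assms by simp
  finally show ?thesis using assms by (simp add: pos_le_divide_eq mult.commute)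
qed

lemma square_prefix_ratio_le:
  assumes "k \<ge> 2" "n \<ge> 4"
  shows "real (card {w \<in> words k n. has_square_prefix w}) / real k ^ n
           \<le> 1 / (real k - 1) - 1 / real k ^ 3"
proof -
  let ?B = "\<lambda>i. (\<lambda>(x, y). x @ x @ y) ` (square_roots k i \<times> words k (n - 2 * i))"
  have fin: "finite (square_roots k i)" for i
    by (simp add: square_roots_def)
  have B: "real (card (?B i)) / real k ^ n \<le> 1 / real k ^ i - (if i = 2 then 1 / real k ^ 3 else 0)"
    if "i \<in> {1..n div 2}" for i
  proof -
    \<comment> \<open>The range of \<open>i\<close> gives \<open>2 * i \<le> n\<close>, so the
      truncated subtraction is exact.\<close>
    from that have n: "n = (n - 2 * i) + 2 * i" by auto
    have "card (?B i) \<le> card (square_roots k i) * k ^ (n - 2 * i)"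
      using card_image_le[of "square_roots k i \<times> words k (n - 2 * i)"] fin
      by (simp add: card_cartesian_product)
    then have "real (card (?B i)) \<le> real (card (square_roots k i)) * real k ^ (n - 2 * i)"
      by (simp flip: of_nat_mult of_nat_power)
    also have "\<dots> \<le> (real k ^ i - (if i = 2 then real k else 0)) * real k ^ (n - 2 * i)"
      by (intro mult_right_mono card_square_roots_le) auto
    finally have "real (card (?B i)) / real k ^ n
        \<le> (real k ^ i - (if i = 2 then real k else 0)) * real k ^ (n - 2 * i) / real k ^ n"
      by (rule divide_right_mono) simp
    also have "\<dots> = (real k ^ i - (if i = 2 then real k else 0)) / real k ^ (2 * i)"
    proof -
      have "real k ^ n = real k ^ (n - 2 * i) * real k ^ (2 * i)"
        by (subst n) (rule power_add)
      then show ?thesis using assms(1) by simp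
    qed
    \<comment> \<open>For \<open>i = 2\<close> this is \<open>(k^2 - k) / k^4\<close>, which is the
      source of the saving \<open>1 / k^3\<close>.\<close>
    also have "\<dots> = 1 / real k ^ i - (if i = 2 then 1 / real k ^ 3 else 0)"
    proof (cases "i = 2")
      case True
      then show ?thesis
        using assms(1) by (simp add: field_simps eval_nat_numeral)
    next
      case False
      then show ?thesis using assms(1) by (simp add: mult_2 power_add)
    qed
    finally show ?thesis .
  qed
  have "card {w \<in> words k n. has_square_prefix w} \<le> card (\<Union>i\<in>{1..n div 2}. ?B i)"
    by (intro card_mono square_prefix_words_subset) (auto intro!: finite_imageI fin)
  also have "\<dots> \<le> (\<Sum>i=1..n div 2. card (?B i))"
    by (rule card_UN_le) simp
  finally have "real (card {w \<in> words k n. has_square_prefix w}) / real k ^ n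
      \<le> (\<Sum>i=1..n div 2. real (card (?B i))) / real k ^ n"
    by (intro divide_right_mono) (simp_all flip: of_nat_sum)
  also have "\<dots> \<le> (\<Sum>i=1..n div 2. 1 / real k ^ i - (if i = 2 then 1 / real k ^ 3 else 0))"
    unfolding sum_divide_distrib by (rule sum_mono) (rule B)
  \<comment> \<open>Here \<open>n \<ge> 4\<close> matters: it puts the index 2 into the range, so
    the correction is subtracted exactly once.\<close>
  also have "\<dots> = (\<Sum>i=1..n div 2. 1 / real k ^ i) - 1 / real k ^ 3"
    using assms(2) by (simp add: sum_subtractf less_eq_div_iff_mult_less_eq)
  also have "\<dots> \<le> 1 / (real k - 1) - 1 / real k ^ 3"
    using sum_inverse_powers_le[of "real k" "n div 2"] assms(1) by simp
  finally show ?thesis .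
qed

theorem theorem15:
  fixes k :: nat
  assumes "k \<ge> 2"
  shows "\<exists>\<alpha>::real. (\<lambda>n. real (num_no_square_prefix k n) / real k ^ n) \<longlonglongrightarrow> \<alpha>
           \<and> \<alpha> > 1 - 1 / (real k - 1)"
proof -
  let ?r = "\<lambda>n. real (num_no_square_prefix k n) / real k ^ n"
  have "decseq ?r"
  proof (rule decseq_SucI)
    fix n
    have "real (num_no_square_prefix k (Suc n)) \<le> real k * real (num_no_square_prefix k n)"
      using num_no_square_prefix_Suc_le[of k n] by (metis of_nat_le_iff of_nat_mult)
    then show "?r (Suc n) \<le> ?r n"
      using assms by (simp add: field_simps)
  qed
  \<comment> \<open>The ratios are nonnegative, so 0 serves as the lower bound.\<close>
  then obtain \<alpha> where lim: "?r \<longlonglongrightarrow> \<alpha>"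
    by (rule decseq_convergent[of _ 0]) auto
  \<comment> \<open>The margin \<open>1 / k^3\<close> does not depend on \<open>n\<close>. Limits
    preserve only weak inequalities, so this fixed margin is what keeps the final bound
    strict.\<close>
  have lower: "1 - 1 / (real k - 1) + 1 / real k ^ 3 \<le> ?r n" if "n \<ge> 4" for n
  proof -
    have "k ^ n = num_no_square_prefix k n + card {w \<in> words k n. has_square_prefix w}"
      unfolding num_no_square_prefix_eq card_words[symmetric]
      by (subst card_Un_disjoint[symmetric]) (auto simp del: card_words intro!: arg_cong[of _ _ card])
    then have "real (num_no_square_prefix k n)
        = real k ^ n - real (card {w \<in> words k n. has_square_prefix w})"
      by (simp flip: of_nat_power)
    then have "?r n = 1 - real (card {w \<in> words k n. has_square_prefix w}) / real k ^ n"
      using assms by (simp add: diff_divide_distrib)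
    then show ?thesis
      using square_prefix_ratio_le[OF assms that] by simp
  qed
  have "1 - 1 / (real k - 1) + 1 / real k ^ 3 \<le> \<alpha>"
    using lim lower by (intro LIMSEQ_le_const) auto
  moreover have "1 / real k ^ 3 > 0"
    using assms by simp
  ultimately have "\<alpha> > 1 - 1 / (real k - 1)"
    by linarith
  with lim show ?thesis by blast
qed

end
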